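(* Let $X\subset\mathbb{R}^n$, let $\mathcal{H}$ be a Hilbert space of functions on $X$ with inner product $\langle f_1,f_2\rangle=\int_X f_1(x)\overline{f_2}(x)\,dx$, and let $F:X\to X$ be a state transition function. Suppose observables $\{g_1,g_2,g_3,\dots\}$ form an independent and complete set of basis functions spanning $\mathcal{H}$, and that $$g_i\circ F\in\mathcal{H},\qquad i=1,2,3,\dots$$ Then the state transition equation $$\chi[F(x)]=A\,\chi(x)$$ exists, with lifted state and state transition matrix given, respectively, by $$\chi=\begin{bmatrix}g_1\\ g_2\\ \vdots\end{bmatrix},\qquad A=QR^{-1},$$ where $$R=\begin{bmatrix}\langle g_1,g_1\rangle & \langle g_1,g_2\rangle & \cdots\\ \langle g_2,g_1\rangle & \langle g_2,g_2\rangle & \cdots\\ \vdots & \vdots & \ddots\end{bmatrix},\qquad Q=\begin{bmatrix}\langle g_1\circ F,g_1\rangle & \langle g_1\circ F,g_2\rangle & \cdots\\ \langle g_2\circ F,g_1\rangle & \langle g_2\circ F,g_2\rangle & \cdots\\ \vdots & \vdots & \ddots\end{bmatrix}.$$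
   Context: $F:X\to X$ is a (possibly nonlinear, possibly discontinuous) self-map of $X$, the state transition function of the discrete-time autonomous system $x_{t+1}=F(x_t)$; $(g\circ F)(x)=g[F(x)]$. The bar denotes complex conjugation. An observable is a function in $\mathcal{H}$. "Independent and complete set of basis functions" means a linearly independent family that spans $\mathcal{H}$ (a basis, not necessarily orthonormal). $\chi[F(x)]=[g_1[F(x)]\ \ g_2[F(x)]\ \cdots]^T$, and the infinite matrix $A$ acts on the infinite vector of functions $\chi$ by the usual row-by-column rule, i.e. $g_i\circ F=\sum_k A_{ik}g_k$ for every $i$, in the same sense as basis expansions in $\mathcal{H}$. $Q$, $R$ and $R^{-1}$ are infinite matrices. *)

theory Defs
  imports "HOL-Analysis.Analysis"
begin

definition L2_inner ::
  "(real^'n) set \<Rightarrow> (real^'n \<Rightarrow> complex) \<Rightarrow> (real^'n \<Rightarrow> complex) \<Rightarrow> complex" where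
  "L2_inner X f g = (LINT x|lebesgue_on X. f x * cnj (g x))"

definition L2_norm :: "(real^'n) set \<Rightarrow> (real^'n \<Rightarrow> complex) \<Rightarrow> real" where
  "L2_norm X f = sqrt (Re (L2_inner X f f))"

definition square_integrable :: "(real^'n) set \<Rightarrow> (real^'n \<Rightarrow> complex) \<Rightarrow> bool" where
  "square_integrable X f \<longleftrightarrow>
     f \<in> borel_measurable (lebesgue_on X) \<and>
     integrable (lebesgue_on X) (\<lambda>x. (cmod (f x))\<^sup>2)"

text \<open>
  Functions on \<open>X\<close> are modelled by total functions of which only the values on \<open>X\<close> matter;
  this is the purpose of the clause closing \<open>H\<close> under changes outside \<open>X\<close>.
  Elements of \<open>H\<close> are genuine functions, so that \<open>g \<circ> F\<close> makes sense for an arbitrary map \<open>F\<close>.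
  As a Hilbert space, \<open>H\<close> is understood modulo functions of norm zero: equality and convergence
  in \<open>H\<close> are always expressed through \<open>L2_norm\<close>.  Neither \<open>H\<close> = all square-integrable functions
  nor closure under changes on null subsets of \<open>X\<close> is required.
\<close>

definition hilbert_function_space ::
  "(real^'n) set \<Rightarrow> (real^'n \<Rightarrow> complex) set \<Rightarrow> bool" where
  "hilbert_function_space X H \<longleftrightarrow>
     (\<forall>f\<in>H. square_integrable X f) \<and>
     (\<forall>f\<in>H. \<forall>f'. (\<forall>x\<in>X. f' x = f x) \<longrightarrow> f' \<in> H) \<and>
     (\<lambda>x. 0) \<in> H \<and>
     (\<forall>f\<in>H. \<forall>g\<in>H. (\<lambda>x. f x + g x) \<in> H) \<and>
     (\<forall>f\<in>H. \<forall>c. (\<lambda>x. c * f x) \<in> H) \<and>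
     (\<forall>u. (\<forall>k. u k \<in> H) \<and>
          (\<forall>e>0. \<exists>N. \<forall>m\<ge>N. \<forall>n\<ge>N. L2_norm X (\<lambda>x. u m x - u n x) < e) \<longrightarrow>
          (\<exists>f\<in>H. (\<lambda>n. L2_norm X (\<lambda>x. u n x - f x)) \<longlonglongrightarrow> 0))"

text \<open>The expansion \<open>f = (\<Sum>k. c k * g k)\<close>, convergent in the norm of \<open>H\<close>.\<close>

definition expands ::
  "(real^'n) set \<Rightarrow> (nat \<Rightarrow> real^'n \<Rightarrow> complex) \<Rightarrow> (nat \<Rightarrow> complex) \<Rightarrow> (real^'n \<Rightarrow> complex) \<Rightarrow> bool" where
  "expands X g c f \<longleftrightarrow>
     (\<lambda>N. L2_norm X (\<lambda>x. f x - (\<Sum>k<N. c k * g k x))) \<longlonglongrightarrow> 0"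

text \<open>
  A (Schauder) basis: independence and spanning both refer to norm-convergent expansions.
  No orthogonality, normalisation or unconditionality is required.
\<close>

definition independent_complete_basis ::
  "(real^'n) set \<Rightarrow> (real^'n \<Rightarrow> complex) set \<Rightarrow> (nat \<Rightarrow> real^'n \<Rightarrow> complex) \<Rightarrow> bool" where
  "independent_complete_basis X H g \<longleftrightarrow>
     (\<forall>k. g k \<in> H) \<and>
     (\<forall>c. expands X g c (\<lambda>x. 0) \<longrightarrow> (\<forall>k. c k = 0)) \<and>
     (\<forall>f\<in>H. \<exists>c. expands X g c f)"

definition coefficient_space ::
  "(real^'n) set \<Rightarrow> (real^'n \<Rightarrow> complex) set \<Rightarrow> (nat \<Rightarrow> real^'n \<Rightarrow> complex) \<Rightarrow> (nat \<Rightarrow> complex) set" where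
  "coefficient_space X H g = {c. \<exists>f\<in>H. expands X g c f}"

text \<open>\<open>is_product M N P\<close>: all row-by-column series of \<open>M N\<close> converge, and \<open>M N = P\<close>.\<close>

definition is_product ::
  "(nat \<Rightarrow> nat \<Rightarrow> complex) \<Rightarrow> (nat \<Rightarrow> nat \<Rightarrow> complex) \<Rightarrow> (nat \<Rightarrow> nat \<Rightarrow> complex) \<Rightarrow> bool" where
  "is_product M N P \<longleftrightarrow> (\<forall>i j. (\<lambda>k. M i k * N k j) sums P i j)"

definition identity_matrix :: "nat \<Rightarrow> nat \<Rightarrow> complex" where
  "identity_matrix i j = (if i = j then 1 else 0)"

text \<open>
  Products of infinite matrices are not associative, and a matrix may have several two-sided
  inverses in the sense of row-by-column products (already an invertible tridiagonal Toeplitz Gram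
  matrix does, because \<open>R b = 0\<close> has exponentially growing solutions \<open>b\<close>).  As usual, an inverse
  is therefore taken relative to a sequence space \<open>C\<close> to which its rows belong.
\<close>

definition is_inverse_matrix ::
  "(nat \<Rightarrow> complex) set \<Rightarrow> (nat \<Rightarrow> nat \<Rightarrow> complex) \<Rightarrow> (nat \<Rightarrow> nat \<Rightarrow> complex) \<Rightarrow> bool" where
  "is_inverse_matrix C R S \<longleftrightarrow>
     is_product R S identity_matrix \<and>
     is_product S R identity_matrix \<and>
     (\<forall>i. S i \<in> C)"

definition R_matrix ::
  "(real^'n) set \<Rightarrow> (nat \<Rightarrow> real^'n \<Rightarrow> complex) \<Rightarrow> nat \<Rightarrow> nat \<Rightarrow> complex" where
  "R_matrix X g i j = L2_inner X (g i) (g j)"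

definition Q_matrix ::
  "(real^'n) set \<Rightarrow> (real^'n \<Rightarrow> real^'n) \<Rightarrow> (nat \<Rightarrow> real^'n \<Rightarrow> complex) \<Rightarrow> nat \<Rightarrow> nat \<Rightarrow> complex" where
  "Q_matrix X F g i j = L2_inner X (g i \<circ> F) (g j)"

end

theory Submission imports Defs "HOL-Library.Function_Algebras" begin

text \<open>
  The coefficient functionals of a Schauder basis are continuous by Baire's theorem, so by Riesz they
  are \<open>f \<mapsto> \<langle>f, h j\<rangle>\<close> for a biorthogonal sequence \<open>h\<close>.  The inverse Gram matrix is
  \<open>S i j = \<langle>h i, h j\<rangle>\<close>: its rows are the coefficients of \<open>h i\<close>.  Expanding \<open>h j\<close> in
  \<open>\<langle>f, h j\<rangle>\<close> gives \<open>(\<Sum>k. \<langle>f, g k\<rangle> * S k j) = \<langle>f, h j\<rangle>\<close> for every \<open>f\<close> in \<open>H\<close>.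
  For \<open>f = g i\<close> this says \<open>R S = I\<close>, and for \<open>f = g i \<circ> F\<close> that row \<open>i\<close> of \<open>Q S\<close> consists of the
  coefficients of \<open>g i \<circ> F\<close>.
\<close>

section \<open>Geometry of a complete semi-inner product space\<close>

lemma quadratic_nonneg_imp_zero:
  fixes r s :: real
  assumes "\<And>t. 0 \<le> 2 * t * r + t\<^sup>2 * s" "s \<ge> 0"
  shows "r = 0"
proof -
  \<comment> \<open>The minimiser would be \<open>- r / s\<close>; the shift by one avoids division
    by zero and still gives a negative value unless \<open>r = 0\<close>.\<close>
  define t where "t = - r / (s + 1)"
  have t: "t * (s + 1) = - r" using assms(2) by (simp add: t_def)
  have "0 \<le> (2 * t * r + t\<^sup>2 * s) * (s + 1)\<^sup>2"
    by (intro mult_nonneg_nonneg assms(1)) simp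
  also have "\<dots> = 2 * (t * (s + 1)) * r * (s + 1) + (t * (s + 1))\<^sup>2 * s"
    by (simp add: algebra_simps power2_eq_square)
  also have "\<dots> = - (r\<^sup>2 * (s + 2))"
    unfolding t by (simp add: algebra_simps power2_eq_square)
  finally have "r\<^sup>2 * (s + 2) \<le> 0" by simp
  then show ?thesis using assms(2) by (simp add: mult_le_0_iff)
qed

text \<open>\<open>nm\<close> is only a seminorm, since functions are not identified modulo null functions.\<close>

locale semi_hilbert = vector_space scale
  for scale :: "complex \<Rightarrow> 'v::ab_group_add \<Rightarrow> 'v" (infixr \<open>*s\<close> 75) +
  fixes H :: "'v set" and ip :: "'v \<Rightarrow> 'v \<Rightarrow> complex" and nm :: "'v \<Rightarrow> real"
  assumes subspace_H: "subspace H"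
    and ip_add_left: "\<lbrakk>x \<in> H; y \<in> H; z \<in> H\<rbrakk> \<Longrightarrow> ip (x + y) z = ip x z + ip y z"
    and ip_scale_left: "\<lbrakk>x \<in> H; y \<in> H\<rbrakk> \<Longrightarrow> ip (a *s x) y = a * ip x y"
    and ip_commute: "\<lbrakk>x \<in> H; y \<in> H\<rbrakk> \<Longrightarrow> ip x y = cnj (ip y x)"
    and ip_self_nonneg: "x \<in> H \<Longrightarrow> 0 \<le> Re (ip x x)"
    and nm_eq: "nm x = sqrt (Re (ip x x))"
    and complete: "\<lbrakk>\<And>n. u n \<in> H; \<And>e. e > 0 \<Longrightarrow> \<exists>N. \<forall>m\<ge>N. \<forall>n\<ge>N. nm (u m - u n) < e\<rbrakk>
          \<Longrightarrow> \<exists>x\<in>H. (\<lambda>n. nm (u n - x)) \<longlonglongrightarrow> 0"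
begin

lemma H_closed [simp]:
  "0 \<in> H" "x \<in> H \<Longrightarrow> y \<in> H \<Longrightarrow> x + y \<in> H" "x \<in> H \<Longrightarrow> a *s x \<in> H"
  "x \<in> H \<Longrightarrow> - x \<in> H" "x \<in> H \<Longrightarrow> y \<in> H \<Longrightarrow> x - y \<in> H"
  using subspace_H by (auto simp: subspace_0 subspace_add subspace_scale subspace_neg subspace_diff)

lemma H_sum [simp]: "(\<And>i. i \<in> I \<Longrightarrow> f i \<in> H) \<Longrightarrow> sum f I \<in> H"
  by (rule subspace_sum[OF subspace_H])

lemma ip_add_right: "\<lbrakk>x \<in> H; y \<in> H; z \<in> H\<rbrakk> \<Longrightarrow> ip x (y + z) = ip x y + ip x z"
  by (metis H_closed(2) complex_cnj_add ip_add_left ip_commute)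

lemma ip_scale_right: "\<lbrakk>x \<in> H; y \<in> H\<rbrakk> \<Longrightarrow> ip x (a *s y) = cnj a * ip x y"
  by (metis H_closed(3) complex_cnj_mult ip_commute ip_scale_left)

lemma ip_diff_left: "\<lbrakk>x \<in> H; y \<in> H; z \<in> H\<rbrakk> \<Longrightarrow> ip (x - y) z = ip x z - ip y z"
  using ip_add_left[of "x - y" y z] by simp

lemma ip_diff_right: "\<lbrakk>x \<in> H; y \<in> H; z \<in> H\<rbrakk> \<Longrightarrow> ip x (y - z) = ip x y - ip x z"
  using ip_add_right[of x "y - z" z] by simp

lemma ip_zero_left [simp]: "x \<in> H \<Longrightarrow> ip 0 x = 0"
  using ip_diff_left[of x x x] by simp

lemma ip_sum_right:
  assumes "x \<in> H" "\<And>i. i \<in> I \<Longrightarrow> f i \<in> H"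
  shows "ip x (sum f I) = (\<Sum>i\<in>I. ip x (f i))"
proof -
  have "ip x 0 = 0" using assms(1) ip_commute[of x 0] by simp
  with assms(2) show ?thesis
    by (induction I rule: infinite_finite_induct) (auto simp: ip_add_right assms(1))
qed

lemma nm_nonneg [simp]: "x \<in> H \<Longrightarrow> 0 \<le> nm x"
  by (simp add: nm_eq ip_self_nonneg)

lemma nm_square: "x \<in> H \<Longrightarrow> (nm x)\<^sup>2 = Re (ip x x)"
  by (simp add: nm_eq ip_self_nonneg)

lemma ip_self: "x \<in> H \<Longrightarrow> ip x x = complex_of_real ((nm x)\<^sup>2)"
  using ip_commute[of x x] by (simp add: nm_square complex_eq_iff)

lemma nm_zero [simp]: "nm 0 = 0"
  by (simp add: nm_eq)

lemma nm_scale: "x \<in> H \<Longrightarrow> nm (a *s x) = cmod a * nm x"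
proof -
  assume x: "x \<in> H"
  have "ip (a *s x) (a *s x) = (a * cnj a) * ip x x"
    by (simp add: x ip_scale_left ip_scale_right)
  also have "\<dots> = complex_of_real ((cmod a * nm x)\<^sup>2)"
    unfolding complex_norm_square[symmetric]
    by (simp add: ip_self x power_mult_distrib)
  finally show ?thesis by (simp add: nm_eq[of "a *s x"] x abs_mult)
qed

lemma nm_minus [simp]: "x \<in> H \<Longrightarrow> nm (- x) = nm x"
  using nm_scale[of x "-1"] by (simp add: scale_minus_left)

lemma nm_diff_commute: "\<lbrakk>x \<in> H; y \<in> H\<rbrakk> \<Longrightarrow> nm (x - y) = nm (y - x)"
  using nm_minus[of "x - y"] by simp

lemma nm_add_square: "\<lbrakk>x \<in> H; y \<in> H\<rbrakk> \<Longrightarrow> (nm (x + y))\<^sup>2 = (nm x)\<^sup>2 + 2 * Re (ip x y) + (nm y)\<^sup>2"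
  using ip_commute[of y x] by (simp add: nm_square ip_add_left ip_add_right)

lemma nm_diff_square: "\<lbrakk>x \<in> H; y \<in> H\<rbrakk> \<Longrightarrow> (nm (x - y))\<^sup>2 = (nm x)\<^sup>2 - 2 * Re (ip x y) + (nm y)\<^sup>2"
  using ip_commute[of y x] by (simp add: nm_square ip_diff_left ip_diff_right)

text \<open>The squared norm of \<open>x + t *s y\<close> is a nonnegative real quadratic in
  \<open>t\<close>, so its discriminant is at most zero. If \<open>nm y = 0\<close> the quadratic
  degenerates to an affine function, which is treated apart.\<close>

lemma Re_ip_le:
  assumes "x \<in> H" "y \<in> H"
  shows "Re (ip x y) \<le> nm x * nm y"
proof -
  have *: "0 \<le> (nm x)\<^sup>2 + 2 * t * Re (ip x y) + t\<^sup>2 * (nm y)\<^sup>2" for t :: real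
    using nm_add_square[of x "of_real t *s y"] assms
      zero_le_power2[of "nm (x + of_real t *s y)"]
    by (simp add: ip_scale_right nm_scale power_mult_distrib del: zero_le_power2)
  define r where "r = Re (ip x y)"
  show ?thesis
  proof (cases "nm y = 0")
    case True
    have "r \<le> 0"
    proof (rule ccontr)
      assume r: "\<not> r \<le> 0"
      \<comment> \<open>Here the affine function takes the value -1.\<close>
      define t where "t = - ((nm x)\<^sup>2 + 1) / (2 * r)"
      have "2 * t * r = - ((nm x)\<^sup>2 + 1)" using r by (simp add: t_def)
      then show False using *[of t] True by (simp add: r_def)
    qed
    with True show ?thesis by (simp add: r_def)
  next
    case False
    \<comment> \<open>The minimiser of the quadratic.\<close>
    define t where "t = - r / (nm y)\<^sup>2"
    have t: "t * (nm y)\<^sup>2 = - r" using False by (simp add: t_def)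
    have "t\<^sup>2 * (nm y)\<^sup>2 = - (t * r)" using t by (simp add: power2_eq_square mult.assoc)
    with *[of t] have "0 \<le> (nm x)\<^sup>2 + t * r" by (simp add: r_def)
    then have "0 \<le> ((nm x)\<^sup>2 + t * r) * (nm y)\<^sup>2" by (rule mult_nonneg_nonneg) simp
    also have "\<dots> = (nm x * nm y)\<^sup>2 + (t * (nm y)\<^sup>2) * r"
      by (simp add: power_mult_distrib algebra_simps)
    also have "\<dots> = (nm x * nm y)\<^sup>2 - r\<^sup>2" unfolding t by (simp add: power2_eq_square)
    finally have "r\<^sup>2 \<le> (nm x * nm y)\<^sup>2" by simp
    then show ?thesis unfolding r_def
      by (rule power2_le_imp_le) (intro mult_nonneg_nonneg nm_nonneg assms)
  qed
qed

text \<open>A unimodular factor on \<open>x\<close> makes the inner product real and nonnegative,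
  which reduces the claim to real parts.\<close>

lemma Cauchy_Schwarz:
  assumes "x \<in> H" "y \<in> H"
  shows "cmod (ip x y) \<le> nm x * nm y"
proof -
  obtain a where a: "cmod a = 1" "a * ip x y = of_real (cmod (ip x y))"
  proof (cases "ip x y = 0")
    case False
    have "cnj (ip x y) * ip x y = of_real (cmod (ip x y)) * of_real (cmod (ip x y))"
      using complex_norm_square[of "ip x y"] by (simp add: power2_eq_square mult.commute)
    with False show ?thesis
      by (intro that[of "cnj (ip x y) / of_real (cmod (ip x y))"]) (simp_all add: norm_divide)
  qed (rule that[of 1], simp_all)
  have "cmod (ip x y) = Re (ip (a *s x) y)"
    using a assms by (simp add: ip_scale_left)
  also have "\<dots> \<le> nm (a *s x) * nm y" by (intro Re_ip_le) (use assms in auto)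
  finally show ?thesis using a assms by (simp add: nm_scale)
qed

lemma nm_triangle: "\<lbrakk>x \<in> H; y \<in> H\<rbrakk> \<Longrightarrow> nm (x + y) \<le> nm x + nm y"
  using nm_add_square[of x y] Re_ip_le[of x y]
  by (intro power2_le_imp_le[of "nm (x + y)"] add_nonneg_nonneg nm_nonneg) (simp_all add: power2_sum)

lemma nm_triangle_diff: "\<lbrakk>x \<in> H; y \<in> H\<rbrakk> \<Longrightarrow> nm (x - y) \<le> nm x + nm y"
  using nm_triangle[of x "- y"] by simp

lemma nm_dist_triangle: "\<lbrakk>x \<in> H; y \<in> H; z \<in> H\<rbrakk> \<Longrightarrow> nm (x - z) \<le> nm (x - y) + nm (y - z)"
  using nm_triangle[of "x - y" "y - z"] by simp

lemma nm_sum_le: "(\<And>i. i \<in> I \<Longrightarrow> f i \<in> H) \<Longrightarrow> nm (sum f I) \<le> (\<Sum>i\<in>I. nm (f i))"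
proof (induction I rule: infinite_finite_induct)
  case (insert i I)
  then show ?case using nm_triangle[of "f i" "sum f I"] by fastforce
qed auto

lemma nm_reverse_triangle:
  assumes "x \<in> H" "y \<in> H"
  shows "\<bar>nm x - nm y\<bar> \<le> nm (x - y)"
  using nm_triangle[of "x - y" y] nm_triangle[of "y - x" x] nm_diff_commute[of x y] assms
  by auto

section \<open>Continuity of norm and inner product, Riesz representation\<close>

lemma tendsto_nm:
  assumes "\<And>n. u n \<in> H" "x \<in> H" "(\<lambda>n. nm (u n - x)) \<longlonglongrightarrow> 0"
  shows "(\<lambda>n. nm (u n)) \<longlonglongrightarrow> nm x"
proof (rule LIM_zero_cancel, rule Lim_null_comparison[OF always_eventually assms(3)], rule allI)
  show "norm (nm (u n) - nm x) \<le> nm (u n - x)" for n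
    using nm_reverse_triangle[OF assms(1,2)] by simp
qed

lemma tendsto_ip_right:
  assumes "\<And>n. u n \<in> H" "x \<in> H" "y \<in> H" "(\<lambda>n. nm (x - u n)) \<longlonglongrightarrow> 0"
  shows "(\<lambda>n. ip y (u n)) \<longlonglongrightarrow> ip y x"
proof (rule Lim_transform2[OF tendsto_const])
  have "(\<lambda>n. nm y * nm (x - u n)) \<longlonglongrightarrow> 0"
    using tendsto_mult_right_zero[OF assms(4)] by simp
  then show "(\<lambda>n. ip y x - ip y (u n)) \<longlonglongrightarrow> 0"
  proof (rule Lim_null_comparison[OF always_eventually, rotated], intro allI)
    show "norm (ip y x - ip y (u n)) \<le> nm y * nm (x - u n)" for n
      using Cauchy_Schwarz[of y "x - u n"] assms(1-3) by (simp add: ip_diff_right)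
  qed
qed

text \<open>The representing vector minimises \<open>\<parallel>x\<parallel>\<^sup>2 - 2 Re (\<phi> x)\<close>; the parallelogram law makes minimising
  sequences Cauchy.\<close>

theorem Riesz_representation:
  assumes add: "\<And>x y. x \<in> H \<Longrightarrow> y \<in> H \<Longrightarrow> \<phi> (x + y) = \<phi> x + \<phi> y"
    and scale: "\<And>a x. x \<in> H \<Longrightarrow> \<phi> (a *s x) = a * \<phi> x"
    and bound: "\<And>x. x \<in> H \<Longrightarrow> cmod (\<phi> x) \<le> K * nm x"
  shows "\<exists>h\<in>H. \<forall>x\<in>H. \<phi> x = ip x h"
proof -
  define \<Phi> where "\<Phi> x = (nm x)\<^sup>2 - 2 * Re (\<phi> x)" for x
  have diff: "\<phi> (x - y) = \<phi> x - \<phi> y" if "x \<in> H" "y \<in> H" for x y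
    using add[of "x - y" y] that by simp
  have "- K\<^sup>2 \<le> \<Phi> x" if "x \<in> H" for x
  proof -
    have "Re (\<phi> x) \<le> K * nm x"
      using bound[OF that] complex_Re_le_cmod[of "\<phi> x"] by linarith
    \<comment> \<open>Completing the square in \<open>nm x\<close>.\<close>
    then show ?thesis using zero_le_power2[of "nm x - K"]
      unfolding \<Phi>_def power2_diff by (simp add: algebra_simps)
  qed
  then have bdd: "bdd_below (\<Phi> ` H)" by (intro bdd_belowI2)
  define m where "m = Inf (\<Phi> ` H)"
  have m_le: "m \<le> \<Phi> x" if "x \<in> H" for x
    unfolding m_def using bdd that by (intro cInf_lower) auto
  have "\<exists>x\<in>H. \<Phi> x < m + 1 / real (Suc n)" for n
    using cInf_lessD[of "\<Phi> ` H" "m + 1 / real (Suc n)"] H_closed(1) by (auto simp: m_def simp del: H_closed(1))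
  then have "\<forall>n. \<exists>x. x \<in> H \<and> \<Phi> x < m + 1 / real (Suc n)" by blast
  then obtain u where u: "\<And>n. u n \<in> H" "\<And>n. \<Phi> (u n) < m + 1 / real (Suc n)"
    unfolding choice_iff by blast
  \<comment> \<open>Since \<open>m\<close> also bounds \<open>\<Phi>\<close> at the midpoint of
    \<open>x\<close> and \<open>y\<close>, the parallelogram law controls their distance by how far
    both values exceed \<open>m\<close>.\<close>
  have par: "(nm (x - y))\<^sup>2 \<le> 2 * \<Phi> x + 2 * \<Phi> y - 4 * m" if "x \<in> H" "y \<in> H" for x y
  proof -
    have "m \<le> \<Phi> ((1/2) *s (x + y))" using that by (intro m_le) auto
    also have "\<dots> = (nm (x + y))\<^sup>2 / 4 - Re (\<phi> x + \<phi> y)"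
      using that by (simp add: \<Phi>_def scale add nm_scale norm_divide power_divide add_divide_distrib)
    finally show ?thesis
      using nm_add_square[OF that] nm_diff_square[OF that]
      unfolding \<Phi>_def plus_complex.sel by argo
  qed
  have "\<exists>N. \<forall>k\<ge>N. \<forall>n\<ge>N. nm (u k - u n) < e" if e: "e > 0" for e
  proof -
    \<comment> \<open>The excesses \<open>1 / real (Suc k)\<close> and
      \<open>1 / real (Suc n)\<close> enter \<open>par\<close> with factor 2, so from index
      \<open>N\<close> on they contribute at most \<open>4 / real (Suc N)\<close>.\<close>
    obtain N where N: "4 / real (Suc N) < e\<^sup>2"
    proof -
      have "(\<lambda>n. 4 * (1 / real (Suc n))) \<longlonglongrightarrow> 4 * 0"
        by (intro tendsto_intros LIMSEQ_Suc[OF lim_1_over_n])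
      moreover have "0 < e\<^sup>2" using e by simp
      ultimately have "\<forall>\<^sub>F n in sequentially. 4 * (1 / real (Suc n)) < e\<^sup>2"
        by (intro order_tendstoD) auto
      then show ?thesis using that by (auto simp: eventually_sequentially)
    qed
    have "nm (u k - u n) < e" if kn: "k \<ge> N" "n \<ge> N" for k n
    proof -
      have "(nm (u k - u n))\<^sup>2 \<le> 2 / real (Suc k) + 2 / real (Suc n)"
        using par[OF u(1)[of k] u(1)[of n]] u(2)[of k] u(2)[of n] by simp
      also have "\<dots> \<le> 2 / real (Suc N) + 2 / real (Suc N)"
        using kn by (intro add_mono divide_left_mono) auto
      finally have "(nm (u k - u n))\<^sup>2 < e\<^sup>2" using N by simp
      then show ?thesis using \<open>e > 0\<close> by (auto intro: power2_less_imp_less)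
    qed
    then show ?thesis by blast
  qed
  then obtain h where h: "h \<in> H" "(\<lambda>n. nm (u n - h)) \<longlonglongrightarrow> 0"
    using complete[of u] u(1) by blast
  \<comment> \<open>The bound makes \<open>\<phi>\<close> continuous, so \<open>\<Phi>\<close>
    attains its infimum at \<open>h\<close>.\<close>
  have "(\<lambda>n. \<phi> (u n)) \<longlonglongrightarrow> \<phi> h"
  proof (rule Lim_transform2[OF tendsto_const])
    have "(\<lambda>n. K * nm (u n - h)) \<longlonglongrightarrow> 0"
      using tendsto_mult_right_zero[OF h(2)] by simp
    then show "(\<lambda>n. \<phi> h - \<phi> (u n)) \<longlonglongrightarrow> 0"
    proof (rule Lim_null_comparison[OF always_eventually, rotated], intro allI)
      show "norm (\<phi> h - \<phi> (u n)) \<le> K * nm (u n - h)" for n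
        using bound[of "u n - h"] u(1) h(1) by (simp add: diff norm_minus_commute)
    qed
  qed
  then have "(\<lambda>n. \<Phi> (u n)) \<longlonglongrightarrow> \<Phi> h"
    unfolding \<Phi>_def by (intro tendsto_intros tendsto_nm[OF u(1) h])
  moreover have "(\<lambda>n. m + 1 / real (Suc n)) \<longlonglongrightarrow> m + 0"
    by (intro tendsto_intros LIMSEQ_Suc[OF lim_1_over_n])
  ultimately have "\<Phi> h \<le> m + 0"
    by (rule LIMSEQ_le) (use u(2) in \<open>auto intro: less_imp_le\<close>)
  then have \<Phi>h: "\<Phi> h \<le> m" by simp
  have Re_eq: "Re (\<phi> x) = Re (ip x h)" if x: "x \<in> H" for x
  proof -
    \<comment> \<open>First variation at the minimiser: \<open>2 * t * r\<close> is the linear term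
      of \<open>\<Phi>\<close> along the line through \<open>h\<close> in direction
      \<open>x\<close>, so \<open>r\<close> must vanish.\<close>
    define r where "r = Re (ip x h) - Re (\<phi> x)"
    have "Re (ip h x) = Re (ip x h)" using ip_commute[of h x] h x by simp
    then have "0 \<le> 2 * t * r + t\<^sup>2 * (nm x)\<^sup>2" for t :: real
      using m_le[of "h + of_real t *s x"] \<Phi>h h x
      unfolding r_def right_diff_distrib
      by (simp add: \<Phi>_def nm_add_square nm_scale ip_scale_right add scale power_mult_distrib)
    then have "r = 0" by (rule quadratic_nonneg_imp_zero) simp
    then show ?thesis by (simp add: r_def)
  qed
  \<comment> \<open>Imaginary parts are read off from real parts at
    \<open>\<i> *s x\<close>.\<close>
  have "\<phi> x = ip x h" if "x \<in> H" for x
    using Re_eq[OF that] Re_eq[of "\<i> *s x"] that h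
    by (simp add: complex_eq_iff scale ip_scale_left)
  with h show ?thesis by blast
qed

section \<open>Baire category for a seminorm\<close>

text \<open>Baire's theorem in the form that one of countably many covering sets is dense in a ball.
  It speaks of a metric, whereas \<open>nm\<close> may vanish off \<open>0\<close>; it is therefore
  applied to the quotient by null vectors, realised as a set of chosen representatives.\<close>

lemma Baire_cover:
  fixes A :: "nat \<Rightarrow> 'v set"
  assumes "H = (\<Union>n. A n)"
  obtains n x r where "x \<in> H" "r > 0"
    "\<And>y e. \<lbrakk>y \<in> H; nm (y - x) < r; e > 0\<rbrakk> \<Longrightarrow> \<exists>a\<in>A n. nm (y - a) < e"
proof -
  define rep where "rep x = (SOME y. y \<in> H \<and> nm (y - x) = 0)" for x
  have rep: "rep x \<in> H" "nm (rep x - x) = 0" if "x \<in> H" for x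
    using someI[of "\<lambda>y. y \<in> H \<and> nm (y - x) = 0" x] that by (auto simp: rep_def)
  \<comment> \<open>Being at distance zero from \<open>x\<close> and from \<open>y\<close> is the
    same condition, so both choices pick the same vector.\<close>
  have rep_cong: "rep x = rep y" if "x \<in> H" "y \<in> H" "nm (x - y) = 0" for x y
  proof -
    have "nm (z - x) = 0 \<longleftrightarrow> nm (z - y) = 0" if "z \<in> H" for z
      using nm_dist_triangle[of z x y] nm_dist_triangle[of z y x] nm_diff_commute[of x y]
        nm_nonneg[of "z - x"] nm_nonneg[of "z - y"] \<open>x \<in> H\<close> \<open>y \<in> H\<close> \<open>nm (x - y) = 0\<close> that by auto
    then show ?thesis unfolding rep_def by metis
  qed
  \<comment> \<open>\<open>Metric_space\<close> asks for symmetry and nonnegativity on the whole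
    type, while \<open>nm\<close> is controlled only on \<open>H\<close>; hence the value 0
    elsewhere.\<close>
  define d where "d x y = (if x \<in> H \<and> y \<in> H then nm (x - y) else 0)" for x y
  define R where "R = rep ` H"
  have RH: "R \<subseteq> H" using rep by (auto simp: R_def)
  have rep_R: "rep x = x" if "x \<in> R" for x
  proof -
    from that obtain z where "z \<in> H" "x = rep z" unfolding R_def by blast
    then show ?thesis using rep[of z] rep_cong[of "rep z" z] by simp
  qed
  interpret Metric_space R d
  proof
    show "d x y = d y x" for x y by (auto simp: d_def nm_diff_commute)
    show "d x y = 0 \<longleftrightarrow> x = y" if "x \<in> R" "y \<in> R" for x y
    proof -
      have "x \<in> H" "y \<in> H" using that RH by blast+
      then show ?thesis using rep_R[OF that(1)] rep_R[OF that(2)] rep_cong[of x y] by (auto simp: d_def)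
    qed
    show "d x z \<le> d x y + d y z" if "x \<in> R" "y \<in> R" "z \<in> R" for x y z
      using that RH nm_dist_triangle[of x y z] by (auto simp: d_def subset_iff)
  qed (auto simp: d_def)
  have "mcomplete"
    unfolding mcomplete_def
  proof (intro allI impI)
    fix u assume "MCauchy u"
    then have u: "\<And>n. u n \<in> R" "\<And>n. u n \<in> H"
      and C: "\<And>e. e > 0 \<Longrightarrow> \<exists>N. \<forall>m n. N \<le> m \<longrightarrow> N \<le> n \<longrightarrow> d (u m) (u n) < e"
      using RH by (auto simp: MCauchy_def)
    have "\<exists>N. \<forall>m\<ge>N. \<forall>n\<ge>N. nm (u m - u n) < e" if "e > 0" for e
      using C[OF that] u by (auto simp: d_def)
    then obtain x where x: "x \<in> H" "(\<lambda>n. nm (u n - x)) \<longlonglongrightarrow> 0"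
      using complete[of u] u by blast
    \<comment> \<open>Replacing the limit by its representative moves it by distance zero.\<close>
    have "d (u n) (rep x) \<le> nm (u n - x)" for n
      using nm_dist_triangle[of "u n" x "rep x"] nm_diff_commute[of x "rep x"] rep[OF x(1)] x u
      by (auto simp: d_def)
    moreover have "\<exists>N. \<forall>n\<ge>N. nm (u n - x) < e" if "e > 0" for e
      using order_tendstoD(2)[OF x(2) that] by (simp add: eventually_sequentially)
    moreover have "rep x \<in> R" using x by (auto simp: R_def)
    ultimately have "limitin mtopology u (rep x) sequentially"
      unfolding limit_metric_sequentially using u by (meson order.strict_trans1)
    then show "\<exists>x. limitin mtopology u x sequentially" by blast
  qed
  have AH: "A n \<subseteq> H" for n using assms by blast
  define T where "T n = mtopology closure_of (rep ` A n)" for n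
  have AR: "rep ` A n \<subseteq> R" for n using AH by (auto simp: R_def)
  have R_eq: "R = (\<Union>n. T n)"
  proof
    have "rep ` A n \<subseteq> T n" for n
      unfolding T_def by (rule closure_of_subset) (simp add: AR)
    moreover have "R = (\<Union>n. rep ` A n)" unfolding R_def using assms by blast
    ultimately show "R \<subseteq> (\<Union>n. T n)" by blast
    show "(\<Union>n. T n) \<subseteq> R" using closure_of_subset_topspace unfolding T_def by fastforce
  qed
  \<comment> \<open>The whole space is open and nonempty, so the union of the closures
    \<open>T n\<close> has interior points, and by Baire one of them does.\<close>
  have "R \<noteq> {}" unfolding R_def using H_closed(1) by blast
  then have "mtopology interior_of (\<Union>(range T)) \<noteq> {}"
    using interior_of_topspace[of mtopology] unfolding R_eq[symmetric] topspace_mtopology by simp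
  moreover have "mtopology interior_of (\<Union>(range T)) = {}" if "\<And>n. mtopology interior_of (T n) = {}"
  proof (rule metric_Baire_category_alt[OF \<open>mcomplete\<close>])
    have "closedin mtopology (T n)" for n unfolding T_def by simp
    with that show "closedin mtopology U \<and> mtopology interior_of U = {}" if "U \<in> range T" for U
      using \<open>U \<in> range T\<close> by blast
  qed simp
  ultimately obtain n where "mtopology interior_of (T n) \<noteq> {}" by blast
  then obtain x r where x: "x \<in> R" "r > 0" "mball x r \<subseteq> T n"
    unfolding metric_interior_of by blast
  show ?thesis
  proof (rule that)
    show "x \<in> H" "r > 0" using x RH by auto
    fix y and e :: real assume y: "y \<in> H" "nm (y - x) < r" "e > 0"
    have "d x (rep y) \<le> nm (y - x)"
      using nm_dist_triangle[of "rep y" y x] nm_diff_commute[of x "rep y"] rep[OF y(1)] y x RH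
      by (auto simp: d_def)
    then have "rep y \<in> mball x r" unfolding in_mball using y x by (auto simp: R_def simp del: in_mball)
    then have "rep y \<in> T n" using x by blast
    then obtain b where "b \<in> rep ` A n" "b \<in> mball (rep y) e"
      unfolding T_def metric_closure_of using y(3) by blast
    then obtain a where a: "a \<in> A n" "d (rep y) (rep a) < e" unfolding in_mball by blast
    have aH: "a \<in> H" using a AH by blast
    \<comment> \<open>Passing to representatives costs distance zero, so density carries over from
      the quotient to \<open>A n\<close>.\<close>
    have "nm (y - a) \<le> nm (y - rep y) + (nm (rep y - rep a) + nm (rep a - a))"
      using nm_dist_triangle[of y "rep y" a] nm_dist_triangle[of "rep y" "rep a" a] aH y(1)
        rep(1)[OF y(1)] rep(1)[OF aH] by simp
    also have "\<dots> = d (rep y) (rep a)"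
      using rep[OF aH] rep[OF y(1)] y(1) nm_diff_commute[of y "rep y"] by (simp add: d_def)
    finally show "\<exists>a\<in>A n. nm (y - a) < e" using a by (intro bexI[of _ a]) auto
  qed
qed

end

section \<open>Schauder expansions and their coefficients\<close>

text \<open>It precedes \<open>schauder_basis\<close> because the assumptions of that locale refer
  to it.\<close>

definition (in semi_hilbert) basis_expansion :: "(nat \<Rightarrow> 'v) \<Rightarrow> (nat \<Rightarrow> complex) \<Rightarrow> 'v \<Rightarrow> bool" where
  "basis_expansion g c f \<longleftrightarrow> (\<lambda>N. nm (f - (\<Sum>k<N. c k *s g k))) \<longlonglongrightarrow> 0"

locale schauder_basis = semi_hilbert scale H ip nm
  for scale :: "complex \<Rightarrow> 'v::ab_group_add \<Rightarrow> 'v" (infixr \<open>*s\<close> 75) and H ip nm +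
  fixes g :: "nat \<Rightarrow> 'v"
  assumes g_in_H [simp]: "g k \<in> H"
    and independent: "basis_expansion g c 0 \<Longrightarrow> c k = 0"
    and spanning: "f \<in> H \<Longrightarrow> \<exists>c. basis_expansion g c f"
begin

abbreviation expansion :: "(nat \<Rightarrow> complex) \<Rightarrow> 'v \<Rightarrow> bool" where
  "expansion \<equiv> basis_expansion g"

abbreviation psum :: "(nat \<Rightarrow> complex) \<Rightarrow> nat \<Rightarrow> 'v" where
  "psum c N \<equiv> \<Sum>k<N. c k *s g k"

lemma expansion_add:
  assumes "f \<in> H" "f' \<in> H" "expansion c f" "expansion c' f'"
  shows "expansion (\<lambda>k. c k + c' k) (f + f')"
proof -
  have eq: "f + f' - psum (\<lambda>k. c k + c' k) N = (f - psum c N) + (f' - psum c' N)" for N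
    by (simp add: scale_left_distrib sum.distrib)
  have lim: "(\<lambda>N. nm (f - psum c N) + nm (f' - psum c' N)) \<longlonglongrightarrow> 0"
    using tendsto_add[of _ 0 _ _ 0] assms(3,4) unfolding basis_expansion_def by simp
  show ?thesis unfolding basis_expansion_def
  proof (rule Lim_null_comparison[OF always_eventually lim], rule allI)
    show "norm (nm (f + f' - psum (\<lambda>k. c k + c' k) N)) \<le> nm (f - psum c N) + nm (f' - psum c' N)" for N
      unfolding eq using nm_triangle[of "f - psum c N" "f' - psum c' N"] assms(1,2) by simp
  qed
qed

lemma expansion_scale:
  assumes "f \<in> H" "expansion c f"
  shows "expansion (\<lambda>k. a * c k) (a *s f)"
proof -
  have eq: "a *s f - psum (\<lambda>k. a * c k) N = a *s (f - psum c N)" for N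
    by (simp add: scale_right_diff_distrib scale_sum_right)
  show ?thesis
    using tendsto_mult_right_zero[OF assms(2)[unfolded basis_expansion_def], of "cmod a"] assms(1)
    unfolding basis_expansion_def eq by (simp add: nm_scale)
qed

text \<open>The differences of the coefficients expand \<open>f - f'\<close>, a vector of norm zero;
  they therefore also expand \<open>0\<close>, and independence applies.\<close>

lemma expansion_unique:
  assumes "f \<in> H" "f' \<in> H" "expansion c f" "expansion c' f'" "nm (f - f') = 0"
  shows "c = c'"
proof
  fix k
  let ?c = "\<lambda>k. c k + - 1 * c' k"
  have "expansion ?c (f + - 1 *s f')"
    using assms by (intro expansion_add expansion_scale) auto
  then have lim: "(\<lambda>N. nm (f - f' - psum ?c N)) \<longlonglongrightarrow> 0"
    unfolding basis_expansion_def by (simp add: scale_minus_left)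
  have "expansion ?c 0"
    unfolding basis_expansion_def
  proof (rule Lim_null_comparison[OF always_eventually lim], rule allI)
    fix N
    show "norm (nm (0 - psum ?c N)) \<le> nm (f - f' - psum ?c N)"
      using nm_dist_triangle[of 0 "f - f'" "psum ?c N"] assms nm_minus[of "f - f'"]
      by (simp del: nm_minus add: sum_negf)
  qed
  from independent[OF this, of k] show "c k = c' k" by simp
qed

definition coef :: "'v \<Rightarrow> nat \<Rightarrow> complex" where
  "coef f = (SOME c. expansion c f)"

lemma expansion_coef: "f \<in> H \<Longrightarrow> expansion (coef f) f"
  unfolding coef_def using someI_ex[OF spanning] .

lemma coef_eqI: "f \<in> H \<Longrightarrow> expansion c f \<Longrightarrow> coef f = c"
  using expansion_unique[of f f "coef f" c] expansion_coef by simp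

lemma coef_add: "\<lbrakk>f \<in> H; f' \<in> H\<rbrakk> \<Longrightarrow> coef (f + f') k = coef f k + coef f' k"
  using coef_eqI[OF _ expansion_add[of f f' "coef f" "coef f'"]] expansion_coef by simp

lemma coef_scale: "f \<in> H \<Longrightarrow> coef (a *s f) k = a * coef f k"
  using coef_eqI[OF _ expansion_scale[of f "coef f" a]] expansion_coef by simp

lemma coef_diff: "\<lbrakk>f \<in> H; f' \<in> H\<rbrakk> \<Longrightarrow> coef (f - f') k = coef f k - coef f' k"
  using coef_add[of "f - f'" f' k] by simp

lemma coef_null:
  assumes "f \<in> H" "nm f = 0"
  shows "coef f k = 0"
proof -
  have "expansion (\<lambda>_. 0) f" using assms by (simp add: basis_expansion_def)
  from coef_eqI[OF assms(1) this] show ?thesis by simp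
qed

lemma coef_basis: "coef (g i) = (\<lambda>k. if k = i then 1 else 0)"
proof (rule coef_eqI)
  have "nm (g i - psum (\<lambda>k. if k = i then 1 else 0) N) = 0" if "N \<ge> Suc i" for N
  proof -
    have "psum (\<lambda>k. if k = i then 1 else 0) N = (\<Sum>k<N. if k = i then g k else 0)"
      by (intro sum.cong) auto
    also have "\<dots> = g i" using that by simp
    finally show ?thesis by simp
  qed
  then show "expansion (\<lambda>k. if k = i then 1 else 0) (g i)"
    unfolding basis_expansion_def
    by (intro tendsto_eventually) (auto simp: eventually_sequentially)
qed simp

text \<open>A null vector has only zero coefficients, but \<open>g k\<close> has coefficient 1 at
  \<open>k\<close>.\<close>

lemma nm_basis_pos: "nm (g k) > 0"
proof (rule ccontr)
  assume "\<not> ?thesis"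
  then have "nm (g k) = 0" using nm_nonneg[OF g_in_H, of k] by linarith
  then show False using coef_null[of "g k" k] by (simp add: coef_basis)
qed

section \<open>Continuity of the coefficient functionals\<close>

text \<open>The closed ball of radius \<open>L\<close> for the supremum of the norms of all partial
  sums. Coefficients are plainly continuous in this stronger seminorm; the work lies in comparing it
  with \<open>nm\<close>.\<close>

definition bounded_by :: "real \<Rightarrow> 'v \<Rightarrow> bool" where
  "bounded_by L f \<longleftrightarrow> f \<in> H \<and> (\<forall>N. nm (psum (coef f) N) \<le> L)"

lemma bounded_by_in_H: "bounded_by L f \<Longrightarrow> f \<in> H"
  by (simp add: bounded_by_def)

lemma bounded_by_diff:
  assumes "bounded_by L f" "bounded_by L' f'"
  shows "bounded_by (L + L') (f - f')"
proof -
  have H: "f \<in> H" "f' \<in> H" using assms by (auto simp: bounded_by_def)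
  have "nm (psum (coef (f - f')) N) \<le> L + L'" for N
  proof -
    have "psum (coef (f - f')) N = psum (coef f) N - psum (coef f') N"
      using H by (simp add: coef_diff scale_left_diff_distrib sum_subtractf)
    then show ?thesis
      using nm_triangle_diff[of "psum (coef f) N" "psum (coef f') N"] assms
      unfolding bounded_by_def by (auto intro: order_trans[OF _ add_mono])
  qed
  then show ?thesis using H by (simp add: bounded_by_def)
qed

lemma bounded_by_scale:
  assumes "bounded_by L f"
  shows "bounded_by (cmod a * L) (a *s f)"
proof -
  have H: "f \<in> H" using assms by (auto simp: bounded_by_def)
  have "psum (coef (a *s f)) N = a *s psum (coef f) N" for N
    using H by (simp add: coef_scale scale_sum_right)
  then show ?thesis
    using assms by (simp add: bounded_by_def nm_scale mult_left_mono)
qed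

lemma tendsto_nm_psum: "f \<in> H \<Longrightarrow> (\<lambda>N. nm (psum (coef f) N)) \<longlonglongrightarrow> nm f"
  using expansion_coef[of f] nm_diff_commute[of f "psum (coef f) _"]
  by (intro tendsto_nm) (auto simp: basis_expansion_def)

lemma bounded_by_nm:
  assumes "bounded_by L f"
  shows "nm f \<le> L"
  using assms LIMSEQ_le_const2[OF tendsto_nm_psum] by (auto simp: bounded_by_def)

text \<open>The \<open>k\<close>-th term is a difference of two consecutive partial sums.\<close>

lemma bounded_by_coef:
  assumes "bounded_by L f"
  shows "cmod (coef f k) \<le> 2 * L / nm (g k)"
proof -
  have "cmod (coef f k) * nm (g k) = nm (psum (coef f) (Suc k) - psum (coef f) k)"
    by (simp add: nm_scale)
  also have "\<dots> \<le> nm (psum (coef f) (Suc k)) + nm (psum (coef f) k)"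
    by (rule nm_triangle_diff) auto
  also have "\<dots> \<le> L + L"
    using assms unfolding bounded_by_def by (intro add_mono) blast+
  finally show ?thesis using nm_basis_pos[of k] by (simp add: pos_le_divide_eq)
qed

text \<open>First half of an open mapping argument: each \<open>nm\<close>-ball about 0 lies in the
  closure of a comparable ball for the partial-sum seminorm. Baire makes one such set dense in some
  ball; differences recentre that ball at 0 and scaling reaches all radii.\<close>

lemma bounded_by_approx:
  obtains K where "K \<ge> 0"
    "\<And>f B e. \<lbrakk>f \<in> H; nm f < B; e > 0\<rbrakk> \<Longrightarrow> \<exists>a. bounded_by (K * B) a \<and> nm (f - a) < e"
proof -
  \<comment> \<open>Convergent partial sums are bounded, so integer radii suffice to cover
    \<open>H\<close>.\<close>
  have "\<exists>n. bounded_by (real n) f" if f: "f \<in> H" for f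
  proof -
    have "Bseq (\<lambda>N. nm (psum (coef f) N))"
      using tendsto_nm_psum[OF f] convergentI convergent_imp_Bseq by blast
    then obtain L where "\<And>N. norm (nm (psum (coef f) N)) \<le> L"
      unfolding Bseq_def by blast
    then have "nm (psum (coef f) N) \<le> L" for N by (auto intro: abs_le_D1)
    then have "\<forall>N. nm (psum (coef f) N) \<le> real (nat \<lceil>L\<rceil>)"
      by (meson order_trans real_nat_ceiling_ge)
    with f show ?thesis unfolding bounded_by_def by blast
  qed
  then have "H = (\<Union>n. Collect (bounded_by (real n)))" by (auto simp: bounded_by_in_H)
  then obtain n x r where x: "x \<in> H" "r > 0" and
    approx: "\<And>y e. \<lbrakk>y \<in> H; nm (y - x) < r; e > 0\<rbrakk> \<Longrightarrow> \<exists>a\<in>Collect (bounded_by (real n)). nm (y - a) < e"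
    by (rule Baire_cover) blast
  show ?thesis
  proof (rule that[of "2 * real n / r"])
    fix f and B e :: real assume f: "f \<in> H" "nm f < B" "e > 0"
    have B: "B > 0" using f nm_nonneg[of f] by linarith
    define t where "t = B / r"
    have t: "t > 0" using B x by (simp add: t_def)
    define y where "y = of_real (1 / t) *s f"
    have "nm y = nm f / t" using f(1) t by (simp add: y_def nm_scale norm_divide)
    also have "\<dots> < r" using f(2) t x(2) by (simp add: t_def field_simps)
    finally have y: "y \<in> H" "nm y < r" "f = of_real t *s y"
      using f(1) t by (simp_all add: y_def)
    \<comment> \<open>Approximating both \<open>x + y\<close> and \<open>x\<close> and subtracting
      removes the centre \<open>x\<close>; the two errors \<open>e / (2 * t)\<close> add up to
      \<open>e\<close> after rescaling by \<open>t\<close>.\<close>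
    obtain a where a: "bounded_by (real n) a" "nm (x + y - a) < e / (2 * t)"
      using approx[of "x + y" "e / (2 * t)"] y(1,2) x(1) f(3) t by auto
    obtain b where b: "bounded_by (real n) b" "nm (x - b) < e / (2 * t)"
      using approx[of x "e / (2 * t)"] x f(3) t by auto
    have H: "a \<in> H" "b \<in> H" using a b bounded_by_in_H by auto
    have "bounded_by (cmod (of_real t) * (real n + real n)) (of_real t *s (a - b))"
      using a b by (intro bounded_by_scale bounded_by_diff)
    moreover have "cmod (of_real t) * (real n + real n) = 2 * real n / r * B"
      unfolding norm_of_real abs_of_pos[OF t] by (simp add: t_def)
    ultimately have "bounded_by (2 * real n / r * B) (of_real t *s (a - b))" by simp
    moreover have "nm (f - of_real t *s (a - b)) < e"
    proof -
      have "nm (f - of_real t *s (a - b)) = nm (of_real t *s ((x + y - a) - (x - b)))"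
      proof -
        have eq: "(x + y - a) - (x - b) = y - (a - b)" by (simp add: algebra_simps)
        show ?thesis unfolding eq y(3) scale_right_diff_distrib ..
      qed
      also have "\<dots> = t * nm ((x + y - a) - (x - b))"
        using H x y t by (subst nm_scale) auto
      also have "\<dots> < t * (e / (2 * t) + e / (2 * t))"
      proof (rule mult_strict_left_mono[OF _ t])
        have "nm ((x + y - a) - (x - b)) \<le> nm (x + y - a) + nm (x - b)"
          by (rule nm_triangle_diff) (use H x(1) y(1) in auto)
        then show "nm ((x + y - a) - (x - b)) < e / (2 * t) + e / (2 * t)"
          using a(2) b(2) by linarith
      qed
      also have "\<dots> = e" using t by simp
      finally show ?thesis .
    qed
    ultimately show "\<exists>a. bounded_by (2 * real n / r * B) a \<and> nm (f - a) < e" by blast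
  qed (use x in simp)
qed

text \<open>Zabreiko's argument: \<open>f\<close> is written as a series whose terms \<open>a i\<close> have partial sums of norm at
  most \<open>K B / 2\<^sup>i\<close>; then the coefficient series converge too, and their sums must be the coefficients
  of \<open>f\<close> by uniqueness.\<close>

theorem coef_bounded:
  shows "\<exists>C. \<forall>f\<in>H. cmod (coef f j) \<le> C * nm f"
proof -
  obtain K where K: "K \<ge> 0" and
    approx: "\<And>f B e. \<lbrakk>f \<in> H; nm f < B; e > 0\<rbrakk> \<Longrightarrow> \<exists>a. bounded_by (K * B) a \<and> nm (f - a) < e"
    using bounded_by_approx by blast
  have main: "cmod (coef f j) \<le> 4 * K * B / nm (g j)" if f: "f \<in> H" "nm f < B" for f B
  proof -
    have B: "B > 0" using f nm_nonneg[of f] by linarith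
    define b where "b n = B * (1/2) ^ n" for n :: nat
    have b_pos: "b n > 0" for n using B by (simp add: b_def)
    have b_sums: "b sums (2 * B)"
      using sums_mult[OF geometric_sums[of "1/2 :: real"], of B] by (simp add: b_def[abs_def] mult.commute)
    \<comment> \<open>\<open>y n\<close> is the remainder after \<open>n\<close> approximations, the
      next of which leaves an error below \<open>b (Suc n)\<close>.\<close>
    have "\<exists>y. y 0 = f \<and> (\<forall>n. (y n \<in> H \<and> nm (y n) < b n) \<and> bounded_by (K * b n) (y n - y (Suc n)))"
    proof -
      \<comment> \<open>Dependent choice prescribes no starting value, so \<open>y 0 = f\<close> is
        carried as a conditional clause of the invariant.\<close>
      have "\<exists>y. \<forall>n. ((y n \<in> H \<and> nm (y n) < b n) \<and> (n = 0 \<longrightarrow> y n = f)) \<and> bounded_by (K * b n) (y n - y (Suc n))"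
      proof (rule dependent_nat_choice)
        show "\<exists>y. (y \<in> H \<and> nm y < b 0) \<and> ((0::nat) = 0 \<longrightarrow> y = f)"
          using f by (simp add: b_def)
        fix y n assume y: "(y \<in> H \<and> nm y < b n) \<and> (n = 0 \<longrightarrow> y = f)"
        then obtain a where a: "bounded_by (K * b n) a" "nm (y - a) < b (Suc n)"
          using approx[of y "b n" "b (Suc n)"] b_pos by blast
        show "\<exists>y'. ((y' \<in> H \<and> nm y' < b (Suc n)) \<and> (Suc n = 0 \<longrightarrow> y' = f)) \<and> bounded_by (K * b n) (y - y')"
          by (rule exI[of _ "y - a"]) (use a y bounded_by_in_H[OF a(1)] in simp)
      qed
      then show ?thesis by blast
    qed
    then obtain y where y0: "y 0 = f" and y: "\<And>n. y n \<in> H" "\<And>n. nm (y n) < b n"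
      and ya: "\<And>n. bounded_by (K * b n) (y n - y (Suc n))" by blast
    define a where "a n = y n - y (Suc n)" for n
    have a: "bounded_by (K * b n) (a n)" "a n \<in> H" for n
      using ya y by (auto simp: a_def)
    have sum_a: "(\<Sum>i<n. a i) = f - y n" for n
      unfolding a_def using sum_lessThan_telescope'[of y n] y0 by simp
    have coef_a: "cmod (coef (a i) k) \<le> 2 * (K * b i) / nm (g k)" for i k
      by (rule bounded_by_coef[OF a(1)])
    have bound_sums: "(\<lambda>i. 2 * (K * b i) / nm (g k)) sums (2 * (K * (2 * B)) / nm (g k))" for k
      by (intro sums_divide sums_mult b_sums)
    have summable_a: "summable (\<lambda>i. coef (a i) k)" for k
      by (rule summable_comparison_test'[OF sums_summable[OF bound_sums[of k]]]) (rule coef_a)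
    \<comment> \<open>The candidate coefficients of \<open>f\<close>, summed over the pieces
      \<open>a i\<close>.\<close>
    define d where "d k = (\<Sum>i. coef (a i) k)" for k
    define T where "T i N = nm (a i - psum (coef (a i)) N)" for i N
    have T_nonneg: "0 \<le> T i N" for i N using a by (simp add: T_def)
    have T_le: "T i N \<le> 2 * (K * b i)" for i N
    proof -
      have "nm (psum (coef (a i)) N) \<le> K * b i" using a(1)[of i] by (simp add: bounded_by_def)
      moreover have "T i N \<le> nm (a i) + nm (psum (coef (a i)) N)"
        unfolding T_def by (rule nm_triangle_diff) (use a(2) in auto)
      ultimately show ?thesis using bounded_by_nm[OF a(1)[of i]] by linarith
    qed
    have bound_summable: "summable (\<lambda>i. 2 * (K * b i))"
      by (intro summable_mult sums_summable[OF b_sums])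
    have T_summable: "summable (\<lambda>i. T i N)" for N
      by (rule summable_comparison_test'[OF bound_summable]) (simp add: T_le T_nonneg)
    have T_lim: "(\<lambda>N. T i N) \<longlonglongrightarrow> 0" for i
      using expansion_coef[OF a(2)[of i]] by (simp add: basis_expansion_def T_def)
    \<comment> \<open>Tannery's theorem is dominated convergence for series; the bound
      \<open>2 * (K * b i)\<close> is uniform in \<open>N\<close>.\<close>
    have T_sum_lim: "(\<lambda>N. \<Sum>i. T i N) \<longlonglongrightarrow> (\<Sum>i. 0)"
    proof -
      have "\<forall>\<^sub>F (i, N) in sequentially \<times>\<^sub>F sequentially. norm (T i N) \<le> 2 * (K * b i)"
        by (rule always_eventually) (simp add: T_le T_nonneg)
      from tannerys_theorem[OF T_lim this bound_summable] show ?thesis by simp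
    qed
    have f_diff: "nm (f - psum d N) \<le> (\<Sum>i. T i N)" for N
    proof -
      define e where "e n k = (\<Sum>i<n. coef (a i) k) - d k" for n k
      have e_lim: "(\<lambda>n. e n k) \<longlonglongrightarrow> 0" for k
        using summable_LIMSEQ[OF summable_a[of k]] LIM_zero unfolding e_def d_def by blast
      \<comment> \<open>For fixed \<open>N\<close> the series over \<open>i\<close> is cut at
        \<open>n\<close>: \<open>y n\<close> is what is left of \<open>f\<close>, and
        \<open>e n\<close> is the error in the coefficients. Both contributions vanish as
        \<open>n\<close> grows.\<close>
      have split: "f - psum d N = y n + (\<Sum>i<n. a i - psum (coef (a i)) N) + psum (e n) N" for n
      proof -
        have "(\<Sum>i<n. psum (coef (a i)) N) = (\<Sum>k<N. (\<Sum>i<n. coef (a i) k) *s g k)"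
          by (subst sum.swap) (simp add: scale_sum_left)
        then show ?thesis
          by (simp add: e_def sum_subtractf scale_left_diff_distrib sum_a)
      qed
      have "nm (f - psum d N) \<le> b n + (\<Sum>i<n. T i N) + (\<Sum>k<N. cmod (e n k) * nm (g k))" for n
      proof -
        have "nm (f - psum d N) \<le> nm (y n) + nm (\<Sum>i<n. a i - psum (coef (a i)) N) + nm (psum (e n) N)"
          unfolding split[of n]
          using nm_triangle[of "y n + (\<Sum>i<n. a i - psum (coef (a i)) N)" "psum (e n) N"]
            nm_triangle[of "y n" "\<Sum>i<n. a i - psum (coef (a i)) N"] y(1) a(2) by simp
        also have "\<dots> \<le> b n + (\<Sum>i<n. T i N) + (\<Sum>k<N. cmod (e n k) * nm (g k))"
          unfolding T_def
        proof (intro add_mono)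
          show "nm (y n) \<le> b n" using y(2)[of n] by simp
          show "nm (\<Sum>i<n. a i - psum (coef (a i)) N) \<le> (\<Sum>i<n. nm (a i - psum (coef (a i)) N))"
            by (rule nm_sum_le) (use a(2) in auto)
          show "nm (psum (e n) N) \<le> (\<Sum>k<N. cmod (e n k) * nm (g k))"
            using nm_sum_le[of "{..<N}" "\<lambda>k. e n k *s g k"] by (simp add: nm_scale)
        qed
        finally show ?thesis .
      qed
      moreover have "(\<lambda>n. \<Sum>k<N. cmod (e n k) * nm (g k)) \<longlonglongrightarrow> 0"
        by (intro tendsto_null_sum tendsto_mult_left_zero tendsto_norm_zero e_lim)
      then have "(\<lambda>n. b n + (\<Sum>i<n. T i N) + (\<Sum>k<N. cmod (e n k) * nm (g k)))
          \<longlonglongrightarrow> 0 + (\<Sum>i. T i N) + 0"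
        by (intro tendsto_add[OF tendsto_add] summable_LIMSEQ[OF T_summable]
            summable_LIMSEQ_zero[OF sums_summable[OF b_sums]])
      ultimately show ?thesis
        by (intro LIMSEQ_le_const[of _ "\<Sum>i. T i N" "nm (f - psum d N)"]) (simp, blast)
    qed
    have "expansion d f" unfolding basis_expansion_def
    proof (rule Lim_null_comparison[OF always_eventually, of _ "\<lambda>N. \<Sum>i. T i N"], rule allI)
      show "norm (nm (f - psum d N)) \<le> (\<Sum>i. T i N)" for N
        using f_diff[of N] f(1) by simp
    qed (use T_sum_lim in simp)
    then have "coef f j = d j" using coef_eqI[OF f(1)] by simp
    also have "cmod (d j) \<le> 2 * (K * (2 * B)) / nm (g j)"
      unfolding d_def sums_unique[OF bound_sums[of j]]
      by (rule norm_suminf_le[OF coef_a sums_summable[OF bound_sums]])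
    finally show ?thesis by simp
  qed
  have "cmod (coef f j) \<le> 8 * K / nm (g j) * nm f" if f: "f \<in> H" for f
  proof (cases "nm f = 0")
    case True
    then show ?thesis using coef_null[OF f True] by simp
  next
    case False
    \<comment> \<open>\<open>main\<close> needs a strict bound; taking \<open>B = 2 * nm f\<close>
      turns its constant 4 into 8 and requires a nonzero norm.\<close>
    then have "nm f < 2 * nm f" using nm_nonneg[OF f] by simp
    from main[OF f this] show ?thesis by simp
  qed
  then show ?thesis by blast
qed

section \<open>The biorthogonal sequence and the inverse Gram matrix\<close>

text \<open>These are the vectors \<open>h j\<close>. Riesz determines them only up to null vectors,
  hence the choice.\<close>

definition dual :: "nat \<Rightarrow> 'v" where
  "dual j = (SOME h. h \<in> H \<and> (\<forall>f\<in>H. coef f j = ip f h))"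

lemma dual: "dual j \<in> H" "f \<in> H \<Longrightarrow> ip f (dual j) = coef f j"
proof -
  obtain C where "\<forall>f\<in>H. cmod (coef f j) \<le> C * nm f" using coef_bounded by blast
  then have "\<exists>h\<in>H. \<forall>f\<in>H. coef f j = ip f h"
    by (intro Riesz_representation[of "\<lambda>f. coef f j" C]) (simp_all add: coef_add coef_scale)
  then have "\<exists>h. h \<in> H \<and> (\<forall>f\<in>H. coef f j = ip f h)" by blast
  from someI_ex[OF this, folded dual_def] have *: "dual j \<in> H" "\<forall>f\<in>H. coef f j = ip f (dual j)"
    by blast+
  show "dual j \<in> H" by (rule *)
  show "ip f (dual j) = coef f j" if "f \<in> H" using *(2) that by simp
qed

text \<open>Continuity of the inner product allows pairing the expansion of \<open>u\<close> with
  \<open>f\<close> term by term; the second series is the conjugate of the first.\<close>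

lemma sums_ip_expansion:
  assumes "f \<in> H" "u \<in> H" "expansion c u"
  shows "(\<lambda>k. ip f (g k) * cnj (c k)) sums ip f u"
    and "(\<lambda>k. c k * ip (g k) f) sums ip u f"
proof -
  have "(\<lambda>N. ip f (psum c N)) \<longlonglongrightarrow> ip f u"
    by (rule tendsto_ip_right) (simp_all add: assms(1,2) assms(3)[unfolded basis_expansion_def])
  moreover have "ip f (psum c N) = (\<Sum>k<N. ip f (g k) * cnj (c k))" for N
    using assms(1) by (simp add: ip_sum_right ip_scale_right mult.commute)
  ultimately show *: "(\<lambda>k. ip f (g k) * cnj (c k)) sums ip f u"
    by (simp add: sums_def)
  have "cnj (ip f (g k) * cnj (c k)) = c k * ip (g k) f" for k
    using ip_commute[OF g_in_H assms(1), of k] by simp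
  with * show "(\<lambda>k. c k * ip (g k) f) sums ip u f"
    using sums_cnj[of "\<lambda>k. ip f (g k) * cnj (c k)" "ip f u"] unfolding ip_commute[OF assms(2,1)]
    by (simp only:)
qed

lemma ip_dual_expansion: "expansion (\<lambda>j. ip (dual i) (dual j)) (dual i)"
  using expansion_coef[OF dual(1)[of i]] unfolding dual(2)[OF dual(1)] .

lemma sums_dual:
  assumes "f \<in> H"
  shows "(\<lambda>k. ip f (g k) * ip (dual k) (dual j)) sums coef f j"
  \<comment> \<open>Hermitian symmetry turns the conjugated coefficients of \<open>dual j\<close>
    into column \<open>j\<close> of the inverse Gram matrix.\<close>
  using sums_ip_expansion(1)[OF assms dual(1) ip_dual_expansion[of j]] dual(2)[OF assms]
  unfolding ip_commute[OF dual(1) dual(1), symmetric] by simp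

text \<open>This is \<open>S R = I\<close>: the expansion of \<open>dual i\<close> is paired with
  \<open>g j\<close>, and biorthogonality evaluates the sum.\<close>

lemma sums_dual_basis:
  "(\<lambda>k. ip (dual i) (dual k) * ip (g k) (g j)) sums (if i = j then 1 else 0)"
proof -
  have "ip (dual i) (g j) = cnj (coef (g j) i)"
    using ip_commute[OF dual(1) g_in_H] dual(2)[OF g_in_H] by simp
  then show ?thesis
    using sums_ip_expansion(2)[OF g_in_H dual(1) ip_dual_expansion, of i j]
    by (simp add: coef_basis split: if_splits)
qed

text \<open>A row of a left inverse that lies in the coefficient space comes from a vector
  \<open>f\<close>. Then \<open>f - dual i\<close> is orthogonal to every basis vector, hence by its
  expansion to itself; so it is null and the coefficients agree.\<close>

lemma dual_unique:
  assumes "f \<in> H" "expansion c f"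
    and "\<And>j. (\<lambda>k. c k * ip (g k) (g j)) sums (if i = j then 1 else 0)"
  shows "c j = ip (dual i) (dual j)"
proof -
  define u where "u = f - dual i"
  have u: "u \<in> H" using assms dual by (simp add: u_def)
  have "ip f (g j) = ip (dual i) (g j)" for j
    using sums_unique2[OF assms(3) sums_ip_expansion(2)[OF g_in_H assms(1,2)], of j]
      sums_unique2[OF sums_dual_basis sums_ip_expansion(2)[OF g_in_H dual(1) ip_dual_expansion], of i j]
    by simp
  then have "ip u (g j) = 0" for j
    using assms(1) dual(1) by (simp add: u_def ip_diff_left)
  then have "(\<lambda>_. 0) sums ip u u"
    using sums_ip_expansion(1)[OF u u expansion_coef[OF u]] by simp
  then have "ip u u = 0" by (rule sums_unique2) (rule sums_zero)
  then have "nm u = 0" using ip_self[OF u] by simp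
  then have "c = (\<lambda>j. ip (dual i) (dual j))"
    unfolding u_def
    by (intro expansion_unique[OF assms(1) dual(1) assms(2) ip_dual_expansion])
  then show ?thesis by simp
qed

end

section \<open>Transfer to spaces of square-integrable functions\<close>

text \<open>The product of the moduli is dominated by the sum of their squares.\<close>

lemma square_integrable_cnj_integrable:
  assumes "square_integrable X f" "square_integrable X g"
  shows "integrable (lebesgue_on X) (\<lambda>x. f x * cnj (g x))"
proof (rule Bochner_Integration.integrable_bound)
  show "integrable (lebesgue_on X) (\<lambda>x. (cmod (f x))\<^sup>2 + (cmod (g x))\<^sup>2)"
    using assms by (simp add: square_integrable_def)
  have "(\<lambda>x. cnj (g x)) \<in> borel_measurable (lebesgue_on X)"
    using assms(2) unfolding square_integrable_def
    by (intro borel_measurable_continuous_on[OF continuous_on_cnj[OF continuous_on_id]]) auto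
  then show "(\<lambda>x. f x * cnj (g x)) \<in> borel_measurable (lebesgue_on X)"
    using assms(1) unfolding square_integrable_def by (intro borel_measurable_times) auto
  have "norm (f x * cnj (g x)) \<le> norm ((cmod (f x))\<^sup>2 + (cmod (g x))\<^sup>2)" for x
  proof -
    have "2 * (cmod (f x) * cmod (g x)) \<le> (cmod (f x))\<^sup>2 + (cmod (g x))\<^sup>2"
      using sum_squares_bound[of "cmod (f x)" "cmod (g x)"] by (simp add: mult.assoc)
    moreover have "0 \<le> cmod (f x) * cmod (g x)" by simp
    ultimately show ?thesis unfolding norm_mult complex_mod_cnj real_norm_def by linarith
  qed
  then show "AE x in lebesgue_on X. norm (f x * cnj (g x)) \<le> norm ((cmod (f x))\<^sup>2 + (cmod (g x))\<^sup>2)"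
    by simp
qed

lemma sum_fun_apply: "sum f A x = (\<Sum>i\<in>A. f i x)" for f :: "'i \<Rightarrow> 'a \<Rightarrow> 'b::comm_monoid_add"
  by (induction A rule: infinite_finite_induct) auto

lemma hilbert_function_space_semi_hilbert:
  fixes X :: "(real^'n) set" and H :: "(real^'n \<Rightarrow> complex) set"
  assumes "hilbert_function_space X H"
  shows "semi_hilbert (\<lambda>c f x. c * f x) H (L2_inner X) (L2_norm X)"
proof -
  have sq: "\<And>f. f \<in> H \<Longrightarrow> square_integrable X f" and zero: "(\<lambda>x. 0) \<in> H"
    and add: "\<And>f g. f \<in> H \<Longrightarrow> g \<in> H \<Longrightarrow> (\<lambda>x. f x + g x) \<in> H"
    and scale: "\<And>f c. f \<in> H \<Longrightarrow> (\<lambda>x. c * f x) \<in> H"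
    and complete: "\<And>u. (\<forall>k. u k \<in> H) \<and>
          (\<forall>e>0. \<exists>N. \<forall>m\<ge>N. \<forall>n\<ge>N. L2_norm X (\<lambda>x. u m x - u n x) < e) \<Longrightarrow>
          (\<exists>f\<in>H. (\<lambda>n. L2_norm X (\<lambda>x. u n x - f x)) \<longlonglongrightarrow> 0)"
    using assms unfolding hilbert_function_space_def by blast+
  interpret vs: vector_space "\<lambda>c (f :: real^'n \<Rightarrow> complex) x. c * f x"
    by standard (auto simp: algebra_simps)
  show ?thesis
  proof
    show "vs.subspace H"
      unfolding vs.subspace_def using zero add scale by (simp add: plus_fun_def zero_fun_def)
  next
    fix x y z assume "x \<in> H" "y \<in> H" "z \<in> H"
    then show "L2_inner X (x + y) z = L2_inner X x z + L2_inner X y z"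
      using sq by (simp add: L2_inner_def distrib_right square_integrable_cnj_integrable)
  next
    fix x y a assume "x \<in> H" "y \<in> H"
    then show "L2_inner X (\<lambda>t. a * x t) y = a * L2_inner X x y"
      by (simp add: L2_inner_def mult.assoc)
  next
    fix x y assume "x \<in> H" "y \<in> H"
    have "L2_inner X x y = (LINT t|lebesgue_on X. cnj (y t * cnj (x t)))"
      by (simp add: L2_inner_def mult.commute)
    also have "\<dots> = cnj (L2_inner X y x)"
      unfolding L2_inner_def by (rule Bochner_Integration.integral_cnj)
    finally show "L2_inner X x y = cnj (L2_inner X y x)" .
  next
    fix x assume x: "x \<in> H"
    have "L2_inner X x x = (LINT t|lebesgue_on X. complex_of_real ((cmod (x t))\<^sup>2))"
      unfolding L2_inner_def complex_norm_square ..
    also have "\<dots> = complex_of_real (LINT t|lebesgue_on X. (cmod (x t))\<^sup>2)"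
      by (rule integral_complex_of_real)
    finally show "0 \<le> Re (L2_inner X x x)" by simp
  next
    show "L2_norm X x = sqrt (Re (L2_inner X x x))" for x
      by (simp add: L2_norm_def)
  next
    fix u :: "nat \<Rightarrow> real^'n \<Rightarrow> complex"
    assume "\<And>n. u n \<in> H" "\<And>e. e > 0 \<Longrightarrow> \<exists>N. \<forall>m\<ge>N. \<forall>n\<ge>N. L2_norm X (u m - u n) < e"
    then show "\<exists>x\<in>H. (\<lambda>n. L2_norm X (u n - x)) \<longlonglongrightarrow> 0"
      using complete[of u] by (simp add: fun_diff_def)
  qed
qed

theorem proposition3:
  fixes X :: "(real^'n) set"
    and H :: "(real^'n \<Rightarrow> complex) set"
    and F :: "real^'n \<Rightarrow> real^'n"
    and g :: "nat \<Rightarrow> real^'n \<Rightarrow> complex"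
  assumes "X \<in> sets lebesgue"
    and "hilbert_function_space X H"
    and "F \<in> X \<rightarrow> X"
    and "independent_complete_basis X H g"
    and "\<And>i. g i \<circ> F \<in> H"
  shows "(\<exists>!Rinv. is_inverse_matrix (coefficient_space X H g) (R_matrix X g) Rinv) \<and>
         (\<forall>Rinv. is_inverse_matrix (coefficient_space X H g) (R_matrix X g) Rinv \<longrightarrow>
            (\<exists>A. is_product (Q_matrix X F g) Rinv A \<and>
                 (\<forall>i. expands X g (A i) (g i \<circ> F))))"
proof -
  interpret semi_hilbert "\<lambda>c (f :: real^'n \<Rightarrow> complex) x. c * f x" H "L2_inner X" "L2_norm X"
    by (rule hilbert_function_space_semi_hilbert) fact
  have expands_eq: "expands X g c f \<longleftrightarrow> basis_expansion g c f" for c f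
    by (simp add: expands_def basis_expansion_def fun_diff_def sum_fun_apply)
  interpret schauder_basis "\<lambda>c (f :: real^'n \<Rightarrow> complex) x. c * f x" H "L2_inner X" "L2_norm X" g
    using assms(4) unfolding independent_complete_basis_def expands_eq zero_fun_def[symmetric]
    by unfold_locales auto
  define S where "S i j = L2_inner X (dual i) (dual j)" for i j
  have S: "is_inverse_matrix (coefficient_space X H g) (R_matrix X g) S"
    unfolding is_inverse_matrix_def is_product_def
  proof (intro conjI allI)
    fix i j
    show "(\<lambda>k. R_matrix X g i k * S k j) sums identity_matrix i j"
      using sums_dual[OF g_in_H, of i j]
      by (simp add: R_matrix_def S_def identity_matrix_def coef_basis eq_commute)
    show "(\<lambda>k. S i k * R_matrix X g k j) sums identity_matrix i j"
      using sums_dual_basis[of i j] by (simp add: R_matrix_def S_def identity_matrix_def)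
    show "S i \<in> coefficient_space X H g"
      using ip_dual_expansion[of i] dual(1)[of i]
      unfolding coefficient_space_def expands_eq S_def by blast
  qed
  have unique: "T = S" if T: "is_inverse_matrix (coefficient_space X H g) (R_matrix X g) T" for T
  proof (intro ext)
    fix i j
    \<comment> \<open>The condition that rows belong to the coefficient space supplies the vector
      for \<open>dual_unique\<close>.\<close>
    obtain f where f: "f \<in> H" "basis_expansion g (T i) f"
      using T unfolding is_inverse_matrix_def coefficient_space_def expands_eq by blast
    have "(\<lambda>k. T i k * L2_inner X (g k) (g j)) sums (if i = j then 1 else 0)" for j
      using T unfolding is_inverse_matrix_def is_product_def R_matrix_def identity_matrix_def by blast
    then show "T i j = S i j"
      unfolding S_def by (rule dual_unique[OF f])
  qed
  \<comment> \<open>The witness for \<open>A\<close> has the coefficients of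
    \<open>g i \<circ> F\<close> as row \<open>i\<close>, so the expansion claim is
    immediate.\<close>
  have "is_product (Q_matrix X F g) S (\<lambda>i. coef (g i \<circ> F))"
    unfolding is_product_def Q_matrix_def S_def using sums_dual[OF assms(5)] by blast
  moreover have "expands X g (coef (g i \<circ> F)) (g i \<circ> F)" for i
    unfolding expands_eq by (rule expansion_coef[OF assms(5)])
  ultimately show ?thesis using S unique by blast
qed

end
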